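(* Given $f$ and $g$ in $\mathcal P_2(\mathbb R^3)$ with equal mean velocity, $$d_2\big(\tilde Q_e^+(f,f),\tilde Q_e^+(g,g)\big)\le\frac{3+e^2+\beta^2}{4}\,d_2(f,g).$$
   Context: $\mathcal P_2(\mathbb R^3)$ is the set of Borel probability measures on $\mathbb R^3$ with finite second moment (written as densities $f(v)\,dv$ even if not absolutely continuous). The mean velocity of $f$ is $\int v f(v)\,dv$. Let $0\le e\le 1$ and let $\eta$ be a real random variable with law a probability measure $\mu$ supported in $[-e,\infty)$, with $\langle\eta\rangle=0$ and $\langle\eta^2\rangle=\beta^2$, where $\langle\cdot\rangle$ denotes expectation with respect to $\eta$ (integration against $\mu$). Put $\tilde e=e+\eta\ge0$. For $v,w\in\mathbb R^3$, $\sigma\in S^2$, the post-collision velocity is $$v'=\tfrac12(v+w)+\tfrac{1-\tilde e}{4}(v-w)+\tfrac{1+\tilde e}{4}|v-w|\sigma .$$ The gain operator $\tilde Q_e^+(f,f)$ is the probability measure on $\mathbb R^3$ defined by $$(\varphi,\tilde Q_e^+(f,f))=\frac1{4\pi}\Big\langle\int_{\mathbb R^3}\int_{\mathbb R^3}\int_{S^2} f(v)f(w)\,\varphi(v')\,d\sigma\,dv\,dw\Big\rangle$$ for bounded continuous $\varphi$. With $\hat f(k)=\int e^{-iv\cdot k}\,df(v)$, the Fourier-based metric is, for $s>0$, $d_s(f,g)=\sup_{k\in\mathbb R^3\setminus\{0\}}\dfrac{|\hat f(k)-\hat g(k)|}{|k|^s}$. *)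

theory Defs
  imports "HOL-Probability.Probability"
begin

definition P2 :: "(real^3) measure set" where
  "P2 = {f. prob_space f \<and> sets f = sets borel \<and> integrable f (\<lambda>v. (norm v)\<^sup>2)}"

definition mean_velocity :: "(real^3) measure \<Rightarrow> real^3" where
  "mean_velocity f = (LINT v|f. v)"

definition fourier :: "(real^3) measure \<Rightarrow> real^3 \<Rightarrow> complex" where
  "fourier f k = (CLINT v|f. exp (- \<i> * of_real (v \<bullet> k)))"

text \<open>The supremum may be infinite for general \<^term>\<open>f\<close> and \<^term>\<open>g\<close>, hence
  the values in \<^typ>\<open>ennreal\<close>.\<close>

definition fourier_dist :: "real \<Rightarrow> (real^3) measure \<Rightarrow> (real^3) measure \<Rightarrow> ennreal" where
  "fourier_dist s f g =
     (SUP k\<in>UNIV - {0}. ennreal (norm (fourier f k - fourier g k) / norm k powr s))"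

text \<open>The surface measure \<open>d\<sigma>\<close> of the unit sphere in three dimensions, as a Borel measure on
  the ambient space concentrated on the sphere. It is the one occurring in polar coordinates:
  the area of \<open>A\<close> is \<open>3\<close> times the volume of the cone \<open>{r *\<^sub>R x | x \<in> A, 0 < r \<le> 1}\<close>.
  The three lemmas below (total mass \<open>4 \<pi>\<close>, concentration on the sphere, rotation invariance)
  characterise it.\<close>

definition surface_measure :: "(real^3) measure" where
  "surface_measure = scale_measure 3
     (distr (restrict_space lborel (cball 0 1 - {0})) borel (\<lambda>x. x /\<^sub>R norm x))"

definition post_velocity :: "real \<Rightarrow> real^3 \<Rightarrow> real^3 \<Rightarrow> real^3 \<Rightarrow> real^3" where
  "post_velocity e' v w \<sigma> =
     (1/2) *\<^sub>R (v + w) + ((1 - e') / 4) *\<^sub>R (v - w) + ((1 + e') / 4 * norm (v - w)) *\<^sub>R \<sigma>"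

definition is_gain :: "real \<Rightarrow> real measure \<Rightarrow> (real^3) measure \<Rightarrow> (real^3) measure \<Rightarrow> bool" where
  "is_gain e \<mu> f Q \<longleftrightarrow> prob_space Q \<and> sets Q = sets borel \<and>
     (\<forall>\<phi> :: real^3 \<Rightarrow> real. continuous_on UNIV \<phi> \<and> bounded (range \<phi>) \<longrightarrow>
       (LINT u|Q. \<phi> u) = 1 / (4 * pi) *
         (LINT \<eta>|\<mu>. LINT v|f. LINT w|f. LINT \<sigma>|surface_measure.
            \<phi> (post_velocity (e + \<eta>) v w \<sigma>)))"

text \<open>Existence and uniqueness of this measure is lemma \<open>is_gain_gain\<close> below.\<close>

definition gain :: "real \<Rightarrow> real measure \<Rightarrow> (real^3) measure \<Rightarrow> (real^3) measure" where
  "gain e \<mu> f = (THE Q. is_gain e \<mu> f Q)"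


lemma sets_surface_measure [simp, measurable_cong]: "sets surface_measure = sets borel"
  by (simp add: surface_measure_def)

lemma space_surface_measure [simp]: "space surface_measure = UNIV"
  by (simp add: surface_measure_def space_scale_measure)

lemma normalize_measurable [measurable]:
  "(\<lambda>x::real^3. x /\<^sub>R norm x) \<in> restrict_space lborel S \<rightarrow>\<^sub>M borel"
  by (rule measurable_restrict_space1) simp

lemma emeasure_surface_measure:
  assumes "A \<in> sets borel"
  shows "emeasure surface_measure A =
    3 * emeasure lborel {x \<in> cball 0 1 - {0}. x /\<^sub>R norm x \<in> A}"
proof -
  have "(\<lambda>x::real^3. x /\<^sub>R norm x) -` A \<inter> space (restrict_space lborel (cball 0 1 - {0}))
      = {x \<in> cball 0 1 - {0}. x /\<^sub>R norm x \<in> A}"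
    by (auto simp: space_restrict_space)
  then show ?thesis
    using assms
    by (simp only: surface_measure_def emeasure_scale_measure emeasure_distr normalize_measurable)
       (subst emeasure_restrict_space; auto)
qed

lemma emeasure_surface_measure_UNIV: "emeasure surface_measure UNIV = ennreal (4 * pi)"
proof -
  have "emeasure lborel (cball (0::real^3) 1 - {0}) = emeasure lborel (cball (0::real^3) 1)"
    by (subst emeasure_Diff) auto
  also have "\<dots> = ennreal (4 / 3 * pi)"
    by (simp add: emeasure_cball unit_ball_vol_3)
  finally have "emeasure surface_measure UNIV = ennreal 3 * ennreal (4 / 3 * pi)"
    by (simp add: emeasure_surface_measure set_diff_eq)
  also have "\<dots> = ennreal (4 * pi)"
    by (subst ennreal_mult[symmetric]) auto
  finally show ?thesis .
qed

lemma emeasure_surface_measure_sphere: "emeasure surface_measure (- sphere 0 1) = 0"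
proof -
  have "{x \<in> cball 0 1 - {0}. x /\<^sub>R norm x \<in> - sphere 0 1} = ({} :: (real^3) set)"
    by (auto simp: field_simps)
  then show ?thesis
    by (subst emeasure_surface_measure) (simp_all only: emeasure_empty mult_zero_right, measurable)
qed

lemma distr_surface_measure_rotation:
  fixes T :: "real^3 \<Rightarrow> real^3"
  assumes T: "orthogonal_transformation T"
  shows "distr surface_measure borel T = surface_measure"
proof (rule measure_eqI)
  have lin: "linear T" and nrm: "\<And>x. norm (T x) = norm x"
    using T by (auto simp: orthogonal_transformation)
  have Tm [measurable]: "T \<in> borel \<rightarrow>\<^sub>M borel"
    using lin by (intro borel_measurable_continuous_onI linear_continuous_on linear_conv_bounded_linear[THEN iffD1])
  fix A assume "A \<in> sets (distr surface_measure borel T)"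
  then have A [measurable]: "A \<in> sets borel" by simp
  define C where "C = {x \<in> cball 0 1 - {0}. x /\<^sub>R norm x \<in> A}"
  define D where "D = {x \<in> cball 0 1 - {0}. x /\<^sub>R norm x \<in> T -` A}"
  have TA: "T -` A \<in> sets borel"
    using measurable_sets[OF Tm A] by simp
  have CD_borel: "C \<in> sets borel" "D \<in> sets borel"
    using TA unfolding C_def D_def by measurable
  have Tsc: "T (x /\<^sub>R norm x) = T x /\<^sub>R norm (T x)" for x
    using lin by (simp add: linear_scale nrm)
  have T0: "T x = 0 \<longleftrightarrow> x = 0" for x
    by (metis nrm norm_eq_zero)
  have CD: "C = T ` D"
  proof -
    have "T ` D \<subseteq> C"
      using Tsc nrm T0 by (auto simp: C_def D_def)
    moreover have "y \<in> T ` D" if y: "y \<in> C" for y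
    proof -
      obtain x where x: "y = T x"
        using T by (meson orthogonal_transformation_surj surjD)
      then show ?thesis
        using y Tsc[of x] nrm T0 by (auto simp: C_def D_def)
    qed
    ultimately show ?thesis by auto
  qed
  have Dfin: "emeasure lborel D < \<infinity>" "emeasure lborel C < \<infinity>"
    by (rule le_less_trans[OF emeasure_mono emeasure_lborel_cball_finite[of 0 1]];
        auto simp: C_def D_def)+
  have Dl: "D \<in> lmeasurable"
    by (intro fmeasurableI) (use Dfin CD_borel in auto)
  have "emeasure lborel C = ennreal (measure lborel C)"
    using Dfin by (simp add: emeasure_eq_ennreal_measure)
  also have "measure lborel C = measure lborel D"
    using measure_orthogonal_image[OF T Dl] CD_borel by (simp add: CD)
  also have "ennreal (measure lborel D) = emeasure lborel D"
    using Dfin by (simp add: emeasure_eq_ennreal_measure)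
  finally have "emeasure lborel D = emeasure lborel C" ..
  then show "emeasure (distr surface_measure borel T) A = emeasure surface_measure A"
    using emeasure_surface_measure[OF A] emeasure_surface_measure[OF TA]
    by (simp add: emeasure_distr C_def D_def)
qed simp

lemma finite_surface_measure: "finite_measure surface_measure"
  by (rule finite_measureI) (simp add: emeasure_surface_measure_UNIV)

lemma borel_measure_eqI:
  fixes M N :: "(real^3) measure"
  assumes "prob_space M" "prob_space N" and sets: "sets M = sets borel" "sets N = sets borel"
    and eq: "\<And>\<phi> :: real^3 \<Rightarrow> real. \<lbrakk>continuous_on UNIV \<phi>; bounded (range \<phi>)\<rbrakk> \<Longrightarrow>
      (LINT u|M. \<phi> u) = (LINT u|N. \<phi> u)"
  shows "M = N"
proof -
  interpret M: prob_space M by fact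
  interpret N: prob_space N by fact
  have sp: "space M = UNIV" "space N = UNIV"
    using sets_eq_imp_space_eq[OF sets(1)] sets_eq_imp_space_eq[OF sets(2)] by simp_all
  have opn: "measure M U = measure N U" if U: "open U" for U
  proof (cases "U = UNIV")
    case True
    then show ?thesis using M.prob_space N.prob_space sp by simp
  next
    case False
    define \<phi> where "\<phi> n x = min 1 (real n * infdist x (- U))" for n x
    have c: "continuous_on UNIV (\<phi> n)" for n
      unfolding \<phi>_def by (intro continuous_intros)
    have b: "norm (\<phi> n x) \<le> 1" for n x
      unfolding \<phi>_def by (auto simp: infdist_nonneg)
    have bd: "bounded (range (\<phi> n))" for n
      using b by (auto intro!: boundedI[of _ 1])
    have meas: "\<phi> n \<in> borel_measurable borel" for n
      using c by (rule borel_measurable_continuous_onI)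
    have lim: "(\<lambda>n. \<phi> n x) \<longlonglongrightarrow> indicat_real U x" for x
    proof (cases "x \<in> U")
      case True
      have pos: "infdist x (- U) > 0"
        using in_closed_iff_infdist_zero[of "- U" x] U False True infdist_nonneg[of x "- U"]
        by (auto simp: closed_def less_le)
      obtain m where m: "1 < real m * infdist x (- U)"
        using reals_Archimedean3[OF pos] by blast
      have "\<phi> n x = 1" if "n \<ge> m" for n
      proof -
        have "real m * infdist x (- U) \<le> real n * infdist x (- U)"
          using that pos by (intro mult_right_mono) auto
        then show ?thesis using m by (simp add: \<phi>_def)
      qed
      then show ?thesis
        using True by (intro tendsto_eventually) (auto simp: eventually_sequentially)
    next
      case False
      then show ?thesis by (simp add: \<phi>_def)
    qed
    have ind: "indicat_real U \<in> borel_measurable borel"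
      using U by (intro borel_measurable_indicator) auto
    have conv: "(\<lambda>n. LINT u|K. \<phi> n u) \<longlonglongrightarrow> measure K U"
      if K: "prob_space K" "sets K = sets borel" for K :: "(real^3) measure"
    proof -
      interpret K: prob_space K by fact
      have m: "\<phi> n \<in> borel_measurable K" for n
        using meas by (simp add: measurable_cong_sets[OF K(2) refl])
      have i: "indicat_real U \<in> borel_measurable K"
        using ind by (simp add: measurable_cong_sets[OF K(2) refl])
      have "(\<lambda>n. LINT u|K. \<phi> n u) \<longlonglongrightarrow> (LINT u|K. indicat_real U u)"
        using lim b m i
        by (intro integral_dominated_convergence[where w = "\<lambda>_. 1"]) auto
      then show ?thesis
        using sets_eq_imp_space_eq[OF K(2)] by simp
    qed
    have "(\<lambda>n. LINT u|M. \<phi> n u) = (\<lambda>n. LINT u|N. \<phi> n u)"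
      using eq c bd by auto
    then show ?thesis
      using conv[OF \<open>prob_space M\<close> sets(1)] conv[OF \<open>prob_space N\<close> sets(2)]
      by (metis LIMSEQ_unique)
  qed
  show ?thesis
  proof (rule measure_eqI_generator_eq[where E = "{U. open U}" and \<Omega> = UNIV and A = "\<lambda>_. UNIV"])
    show "Int_stable {U :: (real^3) set. open U}"
      by (auto simp: Int_stable_def)
    show "sets M = sigma_sets UNIV {U. open U}" "sets N = sigma_sets UNIV {U. open U}"
      using sets by (auto simp: borel_def)
  qed (use opn in \<open>auto simp: M.emeasure_eq_measure N.emeasure_eq_measure\<close>)
qed

lemma continuous_post_velocity:
  "continuous_on UNIV (\<lambda>(\<eta>, v, w, \<sigma>). post_velocity (e + \<eta>) v w \<sigma>)"
  unfolding post_velocity_def case_prod_unfold by (intro continuous_intros) auto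

lemma is_gain_gain:
  assumes \<mu>: "prob_space \<mu>" "sets \<mu> = sets borel" and f: "prob_space f" "sets f = sets borel"
  shows "\<exists>!Q. is_gain e \<mu> f Q" and "is_gain e \<mu> f (gain e \<mu> f)"
proof -
  interpret \<mu>: prob_space \<mu> by fact
  interpret f: prob_space f by fact
  interpret S: finite_measure surface_measure by (rule finite_surface_measure)
  interpret fS: finite_measure "f \<Otimes>\<^sub>M surface_measure"
    by (intro finite_measure_pair_measure) unfold_locales
  interpret ffS: finite_measure "f \<Otimes>\<^sub>M (f \<Otimes>\<^sub>M surface_measure)"
    by (intro finite_measure_pair_measure) unfold_locales
  interpret P: finite_measure "\<mu> \<Otimes>\<^sub>M (f \<Otimes>\<^sub>M (f \<Otimes>\<^sub>M surface_measure))"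
    by (intro finite_measure_pair_measure) unfold_locales
  interpret p1: pair_sigma_finite f surface_measure ..
  interpret p2: pair_sigma_finite f "f \<Otimes>\<^sub>M surface_measure" ..
  interpret p3: pair_sigma_finite \<mu> "f \<Otimes>\<^sub>M (f \<Otimes>\<^sub>M surface_measure)" ..
  let ?P = "\<mu> \<Otimes>\<^sub>M (f \<Otimes>\<^sub>M (f \<Otimes>\<^sub>M surface_measure))"
  let ?c = "\<lambda>(\<eta>, v, w, \<sigma>). post_velocity (e + \<eta>) v w \<sigma>"
  have "sets ?P = sets (borel \<Otimes>\<^sub>M (borel \<Otimes>\<^sub>M (borel \<Otimes>\<^sub>M borel)))"
    using \<mu>(2) f(2) by (intro sets_pair_measure_cong) auto
  then have setsP: "sets ?P = sets borel"
    by (simp only: borel_prod)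
  have cm: "?c \<in> ?P \<rightarrow>\<^sub>M borel"
    using borel_measurable_continuous_onI[OF continuous_post_velocity[of e]]
    by (simp add: measurable_cong_sets[OF setsP refl])
  have spf: "space f = UNIV" "space \<mu> = UNIV"
    using sets_eq_imp_space_eq[OF f(2)] sets_eq_imp_space_eq[OF \<mu>(2)] by simp_all
  have massP: "emeasure ?P (space ?P) = ennreal (4 * pi)"
  proof -
    have 1: "emeasure (f \<Otimes>\<^sub>M surface_measure) UNIV = ennreal (4 * pi)"
      using S.emeasure_pair_measure_Times[of UNIV f UNIV] f.emeasure_space_1 sets.top[of f]
      by (simp add: spf emeasure_surface_measure_UNIV)
    have 2: "emeasure (f \<Otimes>\<^sub>M (f \<Otimes>\<^sub>M surface_measure)) UNIV = ennreal (4 * pi)"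
      using fS.emeasure_pair_measure_Times[of UNIV f UNIV] f.emeasure_space_1
        sets.top[of f] sets.top[of "f \<Otimes>\<^sub>M surface_measure"]
      by (simp add: spf 1 space_pair_measure)
    have 3: "emeasure ?P UNIV = ennreal (4 * pi)"
      using ffS.emeasure_pair_measure_Times[of UNIV \<mu> UNIV] \<mu>.emeasure_space_1
        sets.top[of \<mu>] sets.top[of "f \<Otimes>\<^sub>M (f \<Otimes>\<^sub>M surface_measure)"]
      by (simp add: spf 2 space_pair_measure)
    then show ?thesis by (simp add: spf space_pair_measure)
  qed
  define Q where "Q = density (distr ?P borel ?c) (\<lambda>_. ennreal (1 / (4 * pi)))"
  have "is_gain e \<mu> f Q"
    unfolding is_gain_def
  proof (intro conjI allI impI)
    show "prob_space Q"
    proof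
      have "emeasure Q (space Q) = ennreal (1 / (4 * pi)) * emeasure ?P (space ?P)"
        using cm by (simp add: Q_def emeasure_density_const emeasure_distr)
      also have "\<dots> = 1"
        by (simp add: massP flip: ennreal_mult)
      finally show "emeasure Q (space Q) = 1" .
    qed
    show "sets Q = sets borel" by (simp add: Q_def)
    fix \<phi> :: "real^3 \<Rightarrow> real"
    assume "continuous_on UNIV \<phi> \<and> bounded (range \<phi>)"
    then have \<phi>m [measurable]: "\<phi> \<in> borel_measurable borel" and "bounded (range \<phi>)"
      by (auto intro: borel_measurable_continuous_onI)
    then obtain B where B: "\<And>x. norm (\<phi> x) \<le> B"
      by (auto simp: bounded_iff)
    let ?g = "\<lambda>p. \<phi> (?c p)"
    have gm: "?g \<in> borel_measurable ?P"
      using measurable_compose[OF cm \<phi>m] .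
    have i3: "integrable ?P ?g"
      using B gm by (intro P.integrable_const_bound[where B = B]) auto
    have g2: "(\<lambda>q. ?g (\<eta>, q)) \<in> borel_measurable (f \<Otimes>\<^sub>M (f \<Otimes>\<^sub>M surface_measure))" for \<eta>
      using gm by (rule measurable_compose[rotated]) (simp add: measurable_Pair1' spf)
    have i2: "integrable (f \<Otimes>\<^sub>M (f \<Otimes>\<^sub>M surface_measure)) (\<lambda>q. ?g (\<eta>, q))" for \<eta>
      using B g2 by (intro ffS.integrable_const_bound[where B = B]) auto
    have g1: "(\<lambda>q. ?g (\<eta>, v, q)) \<in> borel_measurable (f \<Otimes>\<^sub>M surface_measure)" for \<eta> v
      using g2 by (rule measurable_compose[rotated]) (simp add: measurable_Pair1' spf)
    have i1: "integrable (f \<Otimes>\<^sub>M surface_measure) (\<lambda>q. ?g (\<eta>, v, q))" for \<eta> v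
      using B g1 by (intro fS.integrable_const_bound[where B = B]) auto
    have "(LINT u|Q. \<phi> u) = 1 / (4 * pi) * (LINT p|?P. ?g p)"
      using cm by (simp add: Q_def integral_density integral_distr)
    also have "(LINT p|?P. ?g p) = (LINT \<eta>|\<mu>. LINT q|(f \<Otimes>\<^sub>M (f \<Otimes>\<^sub>M surface_measure)). ?g (\<eta>, q))"
      using p3.integral_fst'[OF i3] by simp
    also have "\<dots> = (LINT \<eta>|\<mu>. LINT v|f. LINT q|(f \<Otimes>\<^sub>M surface_measure). ?g (\<eta>, v, q))"
      using p2.integral_fst'[OF i2] by simp
    also have "\<dots> = (LINT \<eta>|\<mu>. LINT v|f. LINT w|f. LINT \<sigma>|surface_measure. ?g (\<eta>, v, w, \<sigma>))"
      using p1.integral_fst'[OF i1] by simp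
    finally show "(LINT u|Q. \<phi> u) = 1 / (4 * pi) *
         (LINT \<eta>|\<mu>. LINT v|f. LINT w|f. LINT \<sigma>|surface_measure.
            \<phi> (post_velocity (e + \<eta>) v w \<sigma>))" by simp
  qed
  moreover have "R = Q" if "is_gain e \<mu> f R" "is_gain e \<mu> f Q" for R Q
    using that by (intro borel_measure_eqI) (auto simp: is_gain_def)
  ultimately show "\<exists>!Q. is_gain e \<mu> f Q" by blast
  then show "is_gain e \<mu> f (gain e \<mu> f)"
    unfolding gain_def by (rule theI')
qed

end

theory Submission
  imports Defs
begin

text \<open>
  In Fourier variables the gain operator becomes a bilinear expression without the relative
  velocity, by Bobylev's identity. For a fixed value \<open>a = e + \<eta>\<close> of the random restitution
  coefficient, the average over \<open>\<sigma>\<close> of \<open>exp (- \<i> (v' \<bullet> k))\<close> depends on \<open>\<sigma>\<close> only through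
  \<open>|v - w| (\<sigma> \<bullet> k)\<close>. By rotation invariance of the sphere this may be replaced by
  \<open>|k| (\<sigma> \<bullet> (v - w))\<close>, after which the exponential factors into a function of \<open>v\<close> and a function of
  \<open>w\<close>, with wave vectors \<open>k\<^sub>+ = wave_plus a k \<sigma>\<close> and \<open>k\<^sub>- = wave_minus a k \<sigma>\<close>. Integration over
  \<open>v\<close> and \<open>w\<close> turns the two factors into the Fourier transforms of \<open>f\<close> at \<open>k\<^sub>+\<close> and \<open>k\<^sub>-\<close>
  (\<open>fourier_gain_eq_iterated\<close>, \<open>fourier_gain_eq\<close>).

  Fourier transforms of probability measures are bounded by \<open>1\<close>, so
  \<open>|x y - x' y'| \<le> |x - x'| + |y - y'|\<close> applies to the two products. If \<open>d\<close> is the distance of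
  \<open>f\<close> and \<open>g\<close>, the two differences are at most \<open>d |k\<^sub>+|\<^sup>2\<close> and \<open>d |k\<^sub>-|\<^sup>2\<close>. The average of
  \<open>|k\<^sub>+|\<^sup>2 + |k\<^sub>-|\<^sup>2\<close> over the sphere is \<open>(3 + a\<^sup>2) / 4 * |k|\<^sup>2\<close>
  (\<open>integral_wave_sum_norm_square\<close>), since its remaining term is odd in \<open>\<sigma>\<close>. Finally, \<open>\<eta>\<close> is
  centred with variance \<open>\<beta>\<^sup>2\<close>, so the average of \<open>(e + \<eta>)\<^sup>2\<close> is \<open>e\<^sup>2 + \<beta>\<^sup>2\<close>.
\<close>

section \<open>Integration over the sphere\<close>

text \<open>A rotation takes \<open>a\<close> to \<open>b\<close>, and the surface measure does not see it. In Bobylev's identity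
  this is used to exchange the roles of \<open>k\<close> and \<open>v - w\<close>.\<close>

lemma integral_surface_measure_inner_eq:
  fixes h :: "real \<Rightarrow> 'b::{banach, second_countable_topology}" and a b :: "real^3"
  assumes h: "h \<in> borel_measurable borel" and "norm a = norm b"
  shows "(LINT \<sigma>|surface_measure. h (\<sigma> \<bullet> a)) = (LINT \<sigma>|surface_measure. h (\<sigma> \<bullet> b))"
proof -
  obtain T where T: "orthogonal_transformation T" and Ta: "T a = b"
    using orthogonal_transformation_exists[OF assms(2)] by blast
  have lin: "linear T" and inner: "T x \<bullet> T y = x \<bullet> y" for x y
    using T by (auto simp: orthogonal_transformation_def)
  have [measurable]: "T \<in> borel_measurable borel"
    using lin by (intro borel_measurable_continuous_onI linear_continuous_on)
      (simp add: linear_conv_bounded_linear)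
  note [measurable] = h
  have "(LINT \<sigma>|surface_measure. h (\<sigma> \<bullet> a)) = (LINT \<sigma>|surface_measure. h (T \<sigma> \<bullet> b))"
    by (simp add: inner flip: Ta)
  also have "\<dots> = (LINT \<sigma>|distr surface_measure borel T. h (\<sigma> \<bullet> b))"
    by (subst integral_distr) auto
  finally show ?thesis
    by (simp add: distr_surface_measure_rotation[OF T])
qed

lemma measure_surface_measure_UNIV: "measure surface_measure UNIV = 4 * pi"
  by (simp add: measure_def emeasure_surface_measure_UNIV)

lemma AE_surface_measure_norm: "AE \<sigma> in surface_measure. norm \<sigma> = 1"
  using emeasure_surface_measure_sphere
  by (intro AE_I[where N = "- sphere 0 1"]) (auto simp: dist_norm)

lemma integrable_surface_measure_inner: "integrable surface_measure (\<lambda>\<sigma>. \<sigma> \<bullet> k)"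
proof -
  interpret S: finite_measure surface_measure by (rule finite_surface_measure)
  show ?thesis
  proof (rule S.integrable_const_bound[where B = "norm k"])
    show "AE \<sigma> in surface_measure. norm (\<sigma> \<bullet> k) \<le> norm k"
      using AE_surface_measure_norm
      by eventually_elim (metis Cauchy_Schwarz_ineq2 mult_1 real_norm_def)
  qed measurable
qed

lemma integral_surface_measure_inner_eq_0: "(LINT \<sigma>|surface_measure. \<sigma> \<bullet> k) = 0"
  using integral_surface_measure_inner_eq[of "\<lambda>x. x" k "- k"] by simp

section \<open>The wave vectors of a collision\<close>

text \<open>The adjoint variables of a collision: after the rotation that exchanges \<open>k\<close> and \<open>v - w\<close>,
  the phase \<open>v' \<bullet> k\<close> becomes \<open>v \<bullet> wave_plus a k \<sigma> + w \<bullet> wave_minus a k \<sigma>\<close>. The two vectors add up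
  to \<open>k\<close>, which is conservation of momentum.\<close>

definition wave_plus :: "real \<Rightarrow> real^3 \<Rightarrow> real^3 \<Rightarrow> real^3" where
  "wave_plus a k \<sigma> = ((3 - a) / 4) *\<^sub>R k + ((1 + a) / 4 * norm k) *\<^sub>R \<sigma>"

definition wave_minus :: "real \<Rightarrow> real^3 \<Rightarrow> real^3 \<Rightarrow> real^3" where
  "wave_minus a k \<sigma> = ((1 + a) / 4) *\<^sub>R k - ((1 + a) / 4 * norm k) *\<^sub>R \<sigma>"

lemma measurable_wave [measurable]:
  "wave_plus a k \<in> borel_measurable borel"
  "wave_minus a k \<in> borel_measurable borel"
  unfolding wave_plus_def[abs_def] wave_minus_def[abs_def] by measurable

lemma wave_sum_norm_square:
  assumes "norm \<sigma> = 1"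
  shows "(norm (wave_plus a k \<sigma>))\<^sup>2 + (norm (wave_minus a k \<sigma>))\<^sup>2
    = (3 + a\<^sup>2) / 4 * (norm k)\<^sup>2 + (1 - a\<^sup>2) / 4 * norm k * (\<sigma> \<bullet> k)"
proof -
  have s: "\<sigma> \<bullet> \<sigma> = 1" and k: "norm k * norm k = k \<bullet> k"
    using assms by (simp_all add: dot_square_norm flip: power2_eq_square)
  have expand: "(norm (p *\<^sub>R k + (q * n) *\<^sub>R \<sigma>))\<^sup>2 + (norm (q *\<^sub>R k - (q * n) *\<^sub>R \<sigma>))\<^sup>2
    = (p\<^sup>2 + q\<^sup>2) * (k \<bullet> k) + 2 * q\<^sup>2 * (n * n) * (\<sigma> \<bullet> \<sigma>) + 2 * (p * q - q\<^sup>2) * n * (\<sigma> \<bullet> k)" for p q n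
    unfolding power2_norm_eq_inner
    by (simp add: inner_add_left inner_add_right inner_diff_left inner_diff_right
        inner_commute[of k \<sigma>] power2_eq_square algebra_simps)
  have "(norm (wave_plus a k \<sigma>))\<^sup>2 + (norm (wave_minus a k \<sigma>))\<^sup>2
    = (((3 - a) / 4)\<^sup>2 + ((1 + a) / 4)\<^sup>2) * (k \<bullet> k) + 2 * ((1 + a) / 4)\<^sup>2 * (norm k * norm k) * (\<sigma> \<bullet> \<sigma>)
      + 2 * ((3 - a) / 4 * ((1 + a) / 4) - ((1 + a) / 4)\<^sup>2) * norm k * (\<sigma> \<bullet> k)"
    unfolding wave_plus_def wave_minus_def expand ..
  also have "\<dots> = (3 + a\<^sup>2) / 4 * (norm k)\<^sup>2 + (1 - a\<^sup>2) / 4 * norm k * (\<sigma> \<bullet> k)"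
    unfolding s k power2_norm_eq_inner by (simp add: power2_eq_square field_simps)
  finally show ?thesis .
qed

text \<open>Averaging over the sphere removes the term in \<open>\<sigma> \<bullet> k\<close>, which is odd in \<open>\<sigma>\<close>; what is left
  is the contraction factor for a fixed restitution coefficient \<open>a\<close>.\<close>

lemma integral_wave_sum_norm_square:
  "integrable surface_measure (\<lambda>\<sigma>. (norm (wave_plus a k \<sigma>))\<^sup>2 + (norm (wave_minus a k \<sigma>))\<^sup>2)"
  (is "integrable _ ?h")
  "(LINT \<sigma>|surface_measure. (norm (wave_plus a k \<sigma>))\<^sup>2 + (norm (wave_minus a k \<sigma>))\<^sup>2)
    = 4 * pi * ((3 + a\<^sup>2) / 4) * (norm k)\<^sup>2"
proof -
  interpret S: finite_measure surface_measure by (rule finite_surface_measure)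
  let ?q = "\<lambda>\<sigma>. (3 + a\<^sup>2) / 4 * (norm k)\<^sup>2 + (1 - a\<^sup>2) / 4 * norm k * (\<sigma> \<bullet> k)"
  have eq: "AE \<sigma> in surface_measure. ?h \<sigma> = ?q \<sigma>"
    using AE_surface_measure_norm by eventually_elim (rule wave_sum_norm_square)
  have hm: "?h \<in> borel_measurable surface_measure"
    by measurable
  have qm: "?q \<in> borel_measurable surface_measure"
    by measurable
  have q: "integrable surface_measure ?q"
    by (intro Bochner_Integration.integrable_add integrable_mult_right
        integrable_surface_measure_inner) auto
  show "integrable surface_measure ?h"
    using q integrable_cong_AE[OF hm qm eq] by simp
  have "(LINT \<sigma>|surface_measure. ?h \<sigma>) = (LINT \<sigma>|surface_measure. ?q \<sigma>)"
    by (rule integral_cong_AE[OF hm qm eq])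
  also have "\<dots> = 4 * pi * ((3 + a\<^sup>2) / 4) * (norm k)\<^sup>2"
    by (subst Bochner_Integration.integral_add)
      (auto simp: integrable_surface_measure_inner integral_surface_measure_inner_eq_0
        measure_surface_measure_UNIV)
  finally show "(LINT \<sigma>|surface_measure. ?h \<sigma>) = 4 * pi * ((3 + a\<^sup>2) / 4) * (norm k)\<^sup>2" .
qed

section \<open>Bobylev's identity\<close>

lemma norm_fourier_le_1:
  assumes "prob_space f"
  shows "norm (fourier f k) \<le> 1"
proof -
  interpret prob_space f by fact
  have "norm (fourier f k) \<le> (LINT v|f. norm (exp (- \<i> * of_real (v \<bullet> k))))"
    unfolding fourier_def by (rule integral_norm_bound)
  then show ?thesis by (simp add: prob_space)
qed

lemma measurable_fourier:
  assumes "prob_space f" "sets f = sets borel"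
  shows "fourier f \<in> borel_measurable borel"
proof -
  interpret prob_space f by fact
  note [measurable_cong] = assms(2)
  have "(\<lambda>k. CLINT v|f. exp (- \<i> * of_real (v \<bullet> k))) \<in> borel_measurable borel"
    by measurable
  then show ?thesis by (simp add: fourier_def[abs_def])
qed

lemma integral_iterated3:
  fixes h :: "'a \<Rightarrow> 'b \<Rightarrow> 'c \<Rightarrow> 'd::{banach, second_countable_topology}"
  assumes "finite_measure A" "finite_measure B" "finite_measure C"
    and h: "(\<lambda>(x, y, z). h x y z) \<in> borel_measurable (A \<Otimes>\<^sub>M (B \<Otimes>\<^sub>M C))"
    and bound: "\<And>x y z. norm (h x y z) \<le> K"
  shows "(LINT p|(A \<Otimes>\<^sub>M (B \<Otimes>\<^sub>M C)). (case p of (x, y, z) \<Rightarrow> h x y z))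
    = (LINT x|A. LINT y|B. LINT z|C. h x y z)"
proof -
  interpret A: finite_measure A by fact
  interpret B: finite_measure B by fact
  interpret C: finite_measure C by fact
  interpret BC: finite_measure "B \<Otimes>\<^sub>M C" by (intro finite_measure_pair_measure) unfold_locales
  interpret ABC: finite_measure "A \<Otimes>\<^sub>M (B \<Otimes>\<^sub>M C)"
    by (intro finite_measure_pair_measure) unfold_locales
  interpret p: pair_sigma_finite B C ..
  interpret q: pair_sigma_finite A "B \<Otimes>\<^sub>M C" ..
  have "(LINT p|(A \<Otimes>\<^sub>M (B \<Otimes>\<^sub>M C)). (case p of (x, y, z) \<Rightarrow> h x y z))
    = (LINT x|A. LINT r|(B \<Otimes>\<^sub>M C). (case r of (y, z) \<Rightarrow> h x y z))"
    using bound h by (subst q.integral_fst'[symmetric])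
      (auto intro!: ABC.integrable_const_bound[where B = K] simp: case_prod_unfold)
  also have "\<dots> = (LINT x|A. LINT y|B. LINT z|C. h x y z)"
  proof (rule Bochner_Integration.integral_cong[OF refl])
    fix x assume x: "x \<in> space A"
    have m: "(\<lambda>(y, z). h x y z) \<in> borel_measurable (B \<Otimes>\<^sub>M C)"
      using measurable_compose[OF measurable_Pair1'[OF x] h] by (simp add: case_prod_unfold)
    show "(LINT r|(B \<Otimes>\<^sub>M C). (case r of (y, z) \<Rightarrow> h x y z)) = (LINT y|B. LINT z|C. h x y z)"
      using bound m by (subst p.integral_fst'[symmetric])
        (auto intro!: BC.integrable_const_bound[where B = K] simp: case_prod_unfold)
  qed
  finally show ?thesis .
qed

text \<open>Up to the factor \<open>1 / (4 * pi)\<close>, the Fourier transform at \<open>k\<close> of the gain term with the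
  deterministic restitution coefficient \<open>a\<close>, in the form given by Bobylev's identity.\<close>

definition fourier_gain :: "(real^3) measure \<Rightarrow> real^3 \<Rightarrow> real \<Rightarrow> complex" where
  "fourier_gain f k a =
     (CLINT \<sigma>|surface_measure. fourier f (wave_plus a k \<sigma>) * fourier f (wave_minus a k \<sigma>))"

text \<open>Bobylev's identity for a fixed restitution coefficient. For fixed \<open>v\<close> and \<open>w\<close> the integral
  over \<open>\<sigma>\<close> is rewritten by rotation invariance so that the exponential factors; Fubini's theorem
  then moves the integrals over \<open>w\<close> and \<open>v\<close> onto one factor each.\<close>

lemma fourier_gain_eq_iterated:
  assumes f: "prob_space f" "sets f = sets borel"
  shows "fourier_gain f k a = (CLINT v|f. CLINT w|f. CLINT \<sigma>|surface_measure.
    exp (- \<i> * of_real (post_velocity a v w \<sigma> \<bullet> k)))"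
proof -
  interpret f: prob_space f by fact
  interpret S: finite_measure surface_measure by (rule finite_surface_measure)
  interpret fS: finite_measure "f \<Otimes>\<^sub>M surface_measure"
    by (intro finite_measure_pair_measure) unfold_locales
  interpret p: pair_sigma_finite f surface_measure ..
  note [measurable_cong] = f(2)
  note [measurable] = measurable_fourier[OF f]
  let ?e = "\<lambda>v k. exp (- \<i> * complex_of_real (v \<bullet> k))"
  have split: "(CLINT \<sigma>|surface_measure. ?e (post_velocity a v w \<sigma>) k) =
    (CLINT \<sigma>|surface_measure. ?e v (wave_plus a k \<sigma>) * ?e w (wave_minus a k \<sigma>))" for v w
  proof -
    let ?c = "(3 - a) / 4 * (v \<bullet> k) + (1 + a) / 4 * (w \<bullet> k)"
    let ?h = "\<lambda>s. exp (- \<i> * complex_of_real (?c + (1 + a) / 4 * s))"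
    have 1: "post_velocity a v w \<sigma> \<bullet> k = ?c + (1 + a) / 4 * (\<sigma> \<bullet> (norm (v - w) *\<^sub>R k))" for \<sigma>
      unfolding post_velocity_def
      by (simp add: inner_add_left inner_diff_left field_simps)
    have 2: "v \<bullet> wave_plus a k \<sigma> + w \<bullet> wave_minus a k \<sigma>
        = ?c + (1 + a) / 4 * (\<sigma> \<bullet> (norm k *\<^sub>R (v - w)))" for \<sigma>
      unfolding wave_plus_def wave_minus_def
      by (simp add: inner_add_right inner_diff_right inner_commute field_simps)
    have "?e v (wave_plus a k \<sigma>) * ?e w (wave_minus a k \<sigma>)
        = ?h (\<sigma> \<bullet> (norm k *\<^sub>R (v - w)))" for \<sigma>
      unfolding 2[symmetric] by (simp add: distrib_left flip: exp_add)
    moreover have "(CLINT \<sigma>|surface_measure. ?h (\<sigma> \<bullet> (norm (v - w) *\<^sub>R k)))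
        = (CLINT \<sigma>|surface_measure. ?h (\<sigma> \<bullet> (norm k *\<^sub>R (v - w))))"
      by (rule integral_surface_measure_inner_eq) simp_all
    ultimately show ?thesis unfolding 1 by simp
  qed
  have inner: "(CLINT w|f. CLINT \<sigma>|surface_measure. ?e v (wave_plus a k \<sigma>) * ?e w (wave_minus a k \<sigma>))
    = (CLINT \<sigma>|surface_measure. ?e v (wave_plus a k \<sigma>) * fourier f (wave_minus a k \<sigma>))" for v
  proof -
    have "integrable (f \<Otimes>\<^sub>M surface_measure)
        (\<lambda>(w, \<sigma>). ?e v (wave_plus a k \<sigma>) * ?e w (wave_minus a k \<sigma>))"
      by (rule fS.integrable_const_bound[where B = 1]) (auto simp: norm_mult case_prod_unfold)
    from p.Fubini_integral[OF this] show ?thesis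
      by (simp add: fourier_def)
  qed
  have outer: "(CLINT v|f. CLINT \<sigma>|surface_measure. ?e v (wave_plus a k \<sigma>) * fourier f (wave_minus a k \<sigma>))
    = fourier_gain f k a"
  proof -
    have "integrable (f \<Otimes>\<^sub>M surface_measure)
        (\<lambda>(v, \<sigma>). ?e v (wave_plus a k \<sigma>) * fourier f (wave_minus a k \<sigma>))"
      by (rule fS.integrable_const_bound[where B = 1])
        (auto simp: norm_mult case_prod_unfold norm_fourier_le_1[OF f(1)])
    from p.Fubini_integral[OF this] show ?thesis
      by (simp add: fourier_gain_def) (simp add: fourier_def)
  qed
  show ?thesis
    by (simp only: split inner outer)
qed

lemma norm_fourier_gain_le:
  assumes f: "prob_space f" "sets f = sets borel"
  shows "norm (fourier_gain f k a) \<le> 4 * pi"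
proof -
  interpret S: finite_measure surface_measure by (rule finite_surface_measure)
  note [measurable] = measurable_fourier[OF f]
  have b: "norm (fourier f (wave_plus a k \<sigma>) * fourier f (wave_minus a k \<sigma>)) \<le> 1" for \<sigma>
    using norm_fourier_le_1[OF f(1)] by (simp add: norm_mult mult_le_one)
  have "norm (fourier_gain f k a) \<le> (LINT \<sigma>|surface_measure. 1)"
    unfolding fourier_gain_def using b
    by (intro Bochner_Integration.integral_norm_bound_integral
        S.integrable_const_bound[where B = 1]) auto
  then show ?thesis by (simp add: measure_surface_measure_UNIV)
qed

lemma measurable_fourier_gain:
  assumes f: "prob_space f" "sets f = sets borel"
  shows "fourier_gain f k \<in> borel_measurable borel"
proof -
  interpret S: finite_measure surface_measure by (rule finite_surface_measure)
  note [measurable] = measurable_fourier[OF f]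
  show ?thesis
    unfolding fourier_gain_def[abs_def] wave_plus_def wave_minus_def by measurable
qed

text \<open>The gain measure is characterised by real test functions only, hence the identity is
  obtained for the real and the imaginary part of the exponential separately. Such a part is a
  bounded real-linear functional \<open>r\<close>, which has to be moved through the three inner integrals; this
  is done in one step on the product space.\<close>

lemma fourier_gain_eq:
  assumes \<mu>: "prob_space \<mu>" "sets \<mu> = sets borel" and f: "prob_space f" "sets f = sets borel"
  shows "fourier (gain e \<mu> f) k = 1 / (4 * pi) * (CLINT \<eta>|\<mu>. fourier_gain f k (e + \<eta>))"
    and "integrable \<mu> (\<lambda>\<eta>. fourier_gain f k (e + \<eta>))"
proof -
  interpret \<mu>: prob_space \<mu> by fact
  interpret f: prob_space f by fact
  interpret S: finite_measure surface_measure by (rule finite_surface_measure)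
  interpret fS: finite_measure "f \<Otimes>\<^sub>M surface_measure"
    by (intro finite_measure_pair_measure) unfold_locales
  interpret P: finite_measure "f \<Otimes>\<^sub>M (f \<Otimes>\<^sub>M surface_measure)"
    by (intro finite_measure_pair_measure) unfold_locales
  note [measurable_cong] = f(2) \<mu>(2)
  note [measurable] = measurable_fourier_gain[OF f]
  let ?Q = "gain e \<mu> f"
  have gain: "is_gain e \<mu> f ?Q"
    using is_gain_gain(2)[OF \<mu> f] .
  then interpret Q: prob_space ?Q by (simp add: is_gain_def)
  have [measurable_cong]: "sets ?Q = sets borel"
    using gain by (simp add: is_gain_def)
  let ?e = "\<lambda>v. exp (- \<i> * complex_of_real (v \<bullet> k))"
  show int: "integrable \<mu> (\<lambda>\<eta>. fourier_gain f k (e + \<eta>))"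
    by (rule \<mu>.integrable_const_bound[where B = "4 * pi"])
      (auto simp: norm_fourier_gain_le[OF f])
  have part: "r (fourier ?Q k) = 1 / (4 * pi) * (LINT \<eta>|\<mu>. r (fourier_gain f k (e + \<eta>)))"
    if r: "bounded_linear r" and r1: "\<And>z. norm (r z) \<le> norm z" for r :: "complex \<Rightarrow> real"
  proof -
    have [measurable]: "r \<in> borel_measurable borel"
      using r by (intro borel_measurable_continuous_onI linear_continuous_on)
    have bd: "norm (r (?e u)) \<le> 1" for u
      using r1[of "?e u"] by simp
    have c: "continuous_on UNIV (\<lambda>u. r (?e u))"
      by (intro bounded_linear.continuous_on[OF r] continuous_intros)
    have fibre: "r (fourier_gain f k a) = (LINT v|f. LINT w|f. LINT \<sigma>|surface_measure.
        r (?e (post_velocity a v w \<sigma>)))" for a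
    proof -
      let ?P = "f \<Otimes>\<^sub>M (f \<Otimes>\<^sub>M surface_measure)"
      have m: "(\<lambda>(v, w, \<sigma>). ?e (post_velocity a v w \<sigma>)) \<in> borel_measurable ?P"
        unfolding post_velocity_def by measurable
      have mr: "(\<lambda>(v, w, \<sigma>). r (?e (post_velocity a v w \<sigma>))) \<in> borel_measurable ?P"
        unfolding post_velocity_def by measurable
      have fin: "finite_measure f" "finite_measure surface_measure"
        by unfold_locales
      have "r (fourier_gain f k a) = r (CLINT p|?P. (case p of (v, w, \<sigma>) \<Rightarrow> ?e (post_velocity a v w \<sigma>)))"
        unfolding fourier_gain_eq_iterated[OF f]
        by (subst integral_iterated3[OF fin(1) fin m, where K = 1]) auto
      also have "\<dots> = (LINT p|?P. r (case p of (v, w, \<sigma>) \<Rightarrow> ?e (post_velocity a v w \<sigma>)))"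
        using m by (intro integral_bounded_linear[OF r, symmetric] P.integrable_const_bound[where B = 1])
          (auto simp: case_prod_unfold)
      also have "\<dots> = (LINT p|?P. (case p of (v, w, \<sigma>) \<Rightarrow> r (?e (post_velocity a v w \<sigma>))))"
        by (simp add: case_prod_unfold)
      also have "\<dots> = (LINT v|f. LINT w|f. LINT \<sigma>|surface_measure. r (?e (post_velocity a v w \<sigma>)))"
        using bd by (intro integral_iterated3[OF fin(1) fin mr, where K = 1])
      finally show ?thesis .
    qed
    have "r (fourier ?Q k) = (LINT u|?Q. r (?e u))"
      unfolding fourier_def
      by (intro integral_bounded_linear[OF r, symmetric] Q.integrable_const_bound[where B = 1]) auto
    also have "\<dots> = 1 / (4 * pi) * (LINT \<eta>|\<mu>. LINT v|f. LINT w|f. LINT \<sigma>|surface_measure.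
        r (?e (post_velocity (e + \<eta>) v w \<sigma>)))"
      using gain c bd unfolding is_gain_def bounded_iff by blast
    finally show ?thesis by (simp only: fibre)
  qed
  show "fourier ?Q k = 1 / (4 * pi) * (CLINT \<eta>|\<mu>. fourier_gain f k (e + \<eta>))"
  proof (rule complex_eqI)
    show "Re (fourier ?Q k) = Re (1 / (4 * pi) * (CLINT \<eta>|\<mu>. fourier_gain f k (e + \<eta>)))"
      using part[OF bounded_linear_Re] integral_Re[OF int] by (simp add: abs_Re_le_cmod)
    show "Im (fourier ?Q k) = Im (1 / (4 * pi) * (CLINT \<eta>|\<mu>. fourier_gain f k (e + \<eta>)))"
      using part[OF bounded_linear_Im] integral_Im[OF int] by (simp add: abs_Im_le_cmod)
  qed
qed

section \<open>The contraction estimate\<close>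

lemma norm_fourier_gain_diff_le:
  assumes f: "prob_space f" "sets f = sets borel" and g: "prob_space g" "sets g = sets borel"
    and d: "\<And>l. norm (fourier f l - fourier g l) \<le> d * (norm l)\<^sup>2"
  shows "norm (fourier_gain f k a - fourier_gain g k a)
    \<le> 4 * pi * d * (norm k)\<^sup>2 * ((3 + a\<^sup>2) / 4)"
proof -
  interpret S: finite_measure surface_measure by (rule finite_surface_measure)
  note [measurable] = measurable_fourier[OF f] measurable_fourier[OF g]
  let ?p = "\<lambda>f \<sigma>. fourier f (wave_plus a k \<sigma>) * fourier f (wave_minus a k \<sigma>)"
  let ?h = "\<lambda>\<sigma>. d * ((norm (wave_plus a k \<sigma>))\<^sup>2 + (norm (wave_minus a k \<sigma>))\<^sup>2)"
  have n1: "norm (fourier f l) \<le> 1" "norm (fourier g l) \<le> 1" for l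
    using norm_fourier_le_1 f g by auto
  have int: "integrable surface_measure (?p f)" "integrable surface_measure (?p g)"
    using n1 by (auto intro!: S.integrable_const_bound[where B = 1] AE_I2 mult_le_one simp: norm_mult)
  have ptw: "norm (?p f \<sigma> - ?p g \<sigma>) \<le> ?h \<sigma>" for \<sigma>
  proof -
    let ?x = "wave_plus a k \<sigma>" and ?y = "wave_minus a k \<sigma>"
    have "norm (?p f \<sigma> - ?p g \<sigma>) \<le> norm (fourier f ?x - fourier g ?x) + norm (fourier f ?y - fourier g ?y)"
    proof -
      have "?p f \<sigma> - ?p g \<sigma> = (fourier f ?x - fourier g ?x) * fourier f ?y
          + fourier g ?x * (fourier f ?y - fourier g ?y)"
        by (simp add: algebra_simps)
      also have "norm \<dots> \<le> norm (fourier f ?x - fourier g ?x) * norm (fourier f ?y)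
          + norm (fourier g ?x) * norm (fourier f ?y - fourier g ?y)"
        by (metis norm_mult norm_triangle_ineq)
      also have "\<dots> \<le> norm (fourier f ?x - fourier g ?x) + norm (fourier f ?y - fourier g ?y)"
        using n1 by (intro add_mono mult_left_le mult_left_le_one_le) auto
      finally show ?thesis .
    qed
    also have "\<dots> \<le> ?h \<sigma>"
      using d[of ?x] d[of ?y] by (simp add: distrib_left)
    finally show ?thesis .
  qed
  have "norm (fourier_gain f k a - fourier_gain g k a)
      = norm (CLINT \<sigma>|surface_measure. ?p f \<sigma> - ?p g \<sigma>)"
    unfolding fourier_gain_def by (simp add: Bochner_Integration.integral_diff[OF int])
  also have "\<dots> \<le> (LINT \<sigma>|surface_measure. ?h \<sigma>)"
    using int integral_wave_sum_norm_square(1) ptw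
    by (intro Bochner_Integration.integral_norm_bound_integral) auto
  also have "\<dots> = 4 * pi * d * (norm k)\<^sup>2 * ((3 + a\<^sup>2) / 4)"
    by (subst integral_mult_right_zero, subst integral_wave_sum_norm_square(2)) (simp only: mult_ac)
  finally show ?thesis .
qed

text \<open>The supremum excludes \<open>l = 0\<close>, where both transforms equal the total mass \<open>1\<close>. The bound is
  stated there too, because \<open>wave_minus\<close> vanishes when \<open>\<sigma>\<close> points in the direction of \<open>k\<close>.\<close>

lemma fourier_dist_2_finiteD:
  assumes fd: "fourier_dist 2 f g = ennreal d" "0 \<le> d"
    and f: "prob_space f" and g: "prob_space g"
  shows "norm (fourier f l - fourier g l) \<le> d * (norm l)\<^sup>2"
proof (cases "l = 0")
  case True
  have "fourier f 0 = 1" "fourier g 0 = 1"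
    using prob_space.prob_space[OF f] prob_space.prob_space[OF g] by (simp_all add: fourier_def)
  then show ?thesis by (simp add: True)
next
  case False
  then have "ennreal (norm (fourier f l - fourier g l) / norm l powr 2) \<le> ennreal d"
    unfolding fd(1)[symmetric] fourier_dist_def by (intro SUP_upper) auto
  then have "norm (fourier f l - fourier g l) / (norm l)\<^sup>2 \<le> d"
    using False fd(2) by (simp add: powr_numeral)
  then show ?thesis
    using pos_divide_le_eq[of "(norm l)\<^sup>2"] False by simp
qed

theorem theorem5p3:
  fixes e \<beta> :: real and \<mu> :: "real measure" and f g :: "(real^3) measure"
  assumes "0 \<le> e" and "e \<le> 1"
    and "prob_space \<mu>" and "sets \<mu> = sets borel"
    and "AE \<eta> in \<mu>. - e \<le> \<eta>"
    and "integrable \<mu> (\<lambda>\<eta>. \<eta>\<^sup>2)"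
    and "(LINT \<eta>|\<mu>. \<eta>) = 0" and "(LINT \<eta>|\<mu>. \<eta>\<^sup>2) = \<beta>\<^sup>2"
    and "f \<in> P2" and "g \<in> P2"
    and "mean_velocity f = mean_velocity g"
  shows "fourier_dist 2 (gain e \<mu> f) (gain e \<mu> g)
    \<le> ennreal ((3 + e\<^sup>2 + \<beta>\<^sup>2) / 4) * fourier_dist 2 f g"
proof (cases "fourier_dist 2 f g")
  case top
  \<comment> \<open>The right-hand side is infinite, because the factor is positive.\<close>
  have "0 < (3 + e\<^sup>2 + \<beta>\<^sup>2) / 4"
    by (simp add: add_pos_nonneg)
  then show ?thesis
    by (simp add: top ennreal_mult_top)
next
  case (real d)
  interpret \<mu>: prob_space \<mu> by fact
  have f: "prob_space f" "sets f = sets borel" and g: "prob_space g" "sets g = sets borel"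
    using assms(9,10) by (auto simp: P2_def)
  have d: "norm (fourier f l - fourier g l) \<le> d * (norm l)\<^sup>2" for l
    using fourier_dist_2_finiteD[OF real(2,1) f(1) g(1)] .
  have i\<eta>: "integrable \<mu> (\<lambda>\<eta>. \<eta>)"
    by (rule \<mu>.square_integrable_imp_integrable[OF _ assms(6)]) (simp add: measurable_ident_sets[OF assms(4)])
  \<comment> \<open>The linear term in \<open>\<eta>\<close> has mean zero, and the quadratic one has mean \<open>\<beta>\<^sup>2\<close>.\<close>
  have sq: "(3 + (e + \<eta>)\<^sup>2) / 4 = (3 + e\<^sup>2) / 4 + (e / 2) * \<eta> + 1 / 4 * \<eta>\<^sup>2" for \<eta>
    by (simp add: power2_sum add_divide_distrib)
  have imom: "integrable \<mu> (\<lambda>\<eta>. (3 + (e + \<eta>)\<^sup>2) / 4)"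
    unfolding sq
    by (intro Bochner_Integration.integrable_add integrable_mult_right i\<eta> assms(6)) simp
  have mom: "(LINT \<eta>|\<mu>. (3 + (e + \<eta>)\<^sup>2) / 4) = (3 + e\<^sup>2 + \<beta>\<^sup>2) / 4"
  proof -
    have "(LINT \<eta>|\<mu>. (3 + (e + \<eta>)\<^sup>2) / 4)
        = (3 + e\<^sup>2) / 4 + e / 2 * (LINT \<eta>|\<mu>. \<eta>) + 1 / 4 * (LINT \<eta>|\<mu>. \<eta>\<^sup>2)"
      unfolding sq using i\<eta> assms(6) \<mu>.prob_space by simp
    then show ?thesis by (simp add: assms(7,8) add_divide_distrib)
  qed
  have main: "norm (fourier (gain e \<mu> f) k - fourier (gain e \<mu> g) k)
      \<le> (3 + e\<^sup>2 + \<beta>\<^sup>2) / 4 * d * (norm k)\<^sup>2" for k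
  proof -
    note F = fourier_gain_eq[OF assms(3,4) f, where e = e and k = k]
      and G = fourier_gain_eq[OF assms(3,4) g, where e = e and k = k]
    let ?D = "\<lambda>\<eta>. fourier_gain f k (e + \<eta>) - fourier_gain g k (e + \<eta>)"
    have "fourier (gain e \<mu> f) k - fourier (gain e \<mu> g) k = 1 / (4 * pi) * (CLINT \<eta>|\<mu>. ?D \<eta>)"
      unfolding F(1) G(1) Bochner_Integration.integral_diff[OF F(2) G(2)]
      by (simp add: right_diff_distrib)
    then have diff: "norm (fourier (gain e \<mu> f) k - fourier (gain e \<mu> g) k)
        = 1 / (4 * pi) * norm (CLINT \<eta>|\<mu>. ?D \<eta>)"
      by (simp add: norm_mult norm_divide)
    have "norm (CLINT \<eta>|\<mu>. ?D \<eta>)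
        \<le> (LINT \<eta>|\<mu>. 4 * pi * d * (norm k)\<^sup>2 * ((3 + (e + \<eta>)\<^sup>2) / 4))"
      by (intro Bochner_Integration.integral_norm_bound_integral norm_fourier_gain_diff_le[OF f g d]
          Bochner_Integration.integrable_diff integrable_mult_right F(2) G(2) imom)
    also have "\<dots> = 4 * pi * d * (norm k)\<^sup>2 * ((3 + e\<^sup>2 + \<beta>\<^sup>2) / 4)"
      by (simp only: integral_mult_right_zero mom)
    finally have "1 / (4 * pi) * norm (CLINT \<eta>|\<mu>. ?D \<eta>)
        \<le> 1 / (4 * pi) * (4 * pi * d * (norm k)\<^sup>2 * ((3 + e\<^sup>2 + \<beta>\<^sup>2) / 4))"
      by (intro mult_left_mono) simp_all
    then show ?thesis unfolding diff by (simp add: mult_ac)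
  qed
  have "fourier_dist 2 (gain e \<mu> f) (gain e \<mu> g) \<le> ennreal ((3 + e\<^sup>2 + \<beta>\<^sup>2) / 4 * d)"
    unfolding fourier_dist_def
  proof (rule SUP_least)
    fix k :: "real^3" assume "k \<in> UNIV - {0}"
    then show "ennreal (norm (fourier (gain e \<mu> f) k - fourier (gain e \<mu> g) k) / norm k powr 2)
        \<le> ennreal ((3 + e\<^sup>2 + \<beta>\<^sup>2) / 4 * d)"
      using main[of k] by (intro ennreal_leI) (simp add: pos_divide_le_eq powr_numeral)
  qed
  then show ?thesis
    unfolding real(2) by (subst ennreal_mult[symmetric]) (simp_all only: real(1), simp)
qed

end
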